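(* For every graph $G$, \[ -2^{\nu(G)}\le I(G;-1)\le 2^{\nu(G)}, \] where $\nu(G)$ is the cyclomatic number of $G$.
   Context: Graphs are finite, simple and undirected. A stable set is a set of pairwise non-adjacent vertices; if $s_k$ is the number of stable sets of size $k$ (with $s_0=1$), then $I(G;x)=\sum_k s_kx^k$ is the independence polynomial. The cyclomatic number is $\nu(G)=|E(G)|-|V(G)|+p$, where $p$ is the number of connected components of $G$ (equivalently, the dimension of the cycle space of $G$). *)

theory Defs
  imports Complex_Main "HOL-Computational_Algebra.Polynomial" "Graph_Theory.Graph_Theory"
begin

text \<open>
  Finite simple undirected graphs are modelled by the locale \<^locale>\<open>graph\<close>: finite symmetric
  digraphs without loops and without parallel arcs. Each undirected edge is a pair of opposite
  arcs, so edges are counted as the two-element sets of endpoints, not as arcs. The null graph is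
  not excluded.
\<close>

definition edges :: "('a, 'b) pre_digraph \<Rightarrow> 'a set set" where
  "edges G = (\<lambda>e. {tail G e, head G e}) ` arcs G"

definition stable_set :: "('a, 'b) pre_digraph \<Rightarrow> 'a set \<Rightarrow> bool" where
  "stable_set G S \<longleftrightarrow> S \<subseteq> verts G \<and> pairwise (\<lambda>u v. \<not> u \<rightarrow>\<^bsub>G\<^esub> v) S"

definition stable_count :: "('a, 'b) pre_digraph \<Rightarrow> nat \<Rightarrow> nat" where
  "stable_count G k = card {S. stable_set G S \<and> card S = k}"

definition independence_poly :: "('a, 'b) pre_digraph \<Rightarrow> int poly" where
  "independence_poly G = (\<Sum>k\<le>card (verts G). monom (int (stable_count G k)) k)"

definition connected_components :: "('a, 'b) pre_digraph \<Rightarrow> ('a, 'b) pre_digraph set" where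
  "connected_components G = {H. pre_digraph.max_subgraph G Digraph_Component.connected H}"

text \<open>Integer-valued, so that the subtraction is not truncated.\<close>

definition cyclomatic_number :: "('a, 'b) pre_digraph \<Rightarrow> int" where
  "cyclomatic_number G =
    int (card (edges G)) - int (card (verts G)) + int (card (connected_components G))"

end

theory Submission
  imports Defs
begin

text \<open>
  Write \<open>f(W)\<close> for the value at \<open>-1\<close> of the independence polynomial of the subgraph induced by a
  vertex set \<open>W\<close>. Splitting stable sets according to a vertex \<open>v\<close> gives
  \<open>f(W) = f(W - v) - f(W - N[v])\<close>. Deleting \<open>v\<close> lowers the cyclomatic number by \<open>deg v - c\<close>, where
  \<open>c\<close> is the number of components of \<open>W - v\<close> that meet \<open>N(v)\<close>; so the cyclomatic number is
  monotone, and if two neighbours of some \<open>v\<close> lie in the same component of \<open>W - v\<close>, then both terms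
  on the right are at most \<open>2^(\<nu> - 1)\<close> in absolute value by induction. Otherwise \<open>\<nu> = 0\<close>, so there
  are fewer edges than vertices and some vertex \<open>v\<close> has degree at most one. If it is isolated,
  \<open>f(W) = 0\<close>; if it is a leaf with neighbour \<open>u\<close>, then \<open>v\<close> is isolated in \<open>W - u\<close> and
  \<open>f(W) = - f(W - N[u])\<close>.
\<close>

section \<open>Induced subgraphs as vertex sets under a fixed adjacency relation\<close>

locale adjacency =
  fixes A :: "'a rel"
  assumes sym_A: "sym A" and irrefl_A: "irrefl A"
begin

definition nbrs :: "'a set \<Rightarrow> 'a \<Rightarrow> 'a set" where
  "nbrs W v = {u \<in> W. (v, u) \<in> A}"

definition edge_set :: "'a set \<Rightarrow> 'a set set" where
  "edge_set W = {{u, v} | u v. u \<in> W \<and> v \<in> W \<and> (u, v) \<in> A}"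

text \<open>Paths are confined to \<open>W\<close>, so \<open>W\<close> alone stands for the induced
  subgraph. By reflexivity a point \<open>u\<close> outside \<open>W\<close> gets the default value
  \<open>{u}\<close>.\<close>

definition component_of :: "'a set \<Rightarrow> 'a \<Rightarrow> 'a set" where
  "component_of W u = (A \<inter> W \<times> W)\<^sup>* `` {u}"

definition nu :: "'a set \<Rightarrow> int" where
  "nu W = int (card (edge_set W)) - int (card W) + int (card (component_of W ` W))"

definition stable :: "'a set \<Rightarrow> bool" where
  "stable S \<longleftrightarrow> (\<forall>u\<in>S. \<forall>v\<in>S. (u, v) \<notin> A)"

text \<open>The \<open>f\<close> of the overview, summed over stable sets instead of over their
  sizes, so that the recursion needs no coefficients.\<close>

definition alternating_count :: "'a set \<Rightarrow> int" where
  "alternating_count W = (\<Sum>S | S \<subseteq> W \<and> stable S. (- 1) ^ card S)"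

lemma A_sym: "(u, v) \<in> A \<Longrightarrow> (v, u) \<in> A"
  using sym_A by (rule symD)

lemma A_irrefl [simp]: "(v, v) \<notin> A"
  using irrefl_A by (simp add: irrefl_def)

lemma stable_empty [simp]: "stable {}"
  by (simp add: stable_def)

lemma stable_insert:
  "stable (insert v S) \<longleftrightarrow> stable S \<and> (\<forall>u\<in>S. (v, u) \<notin> A)"
  by (auto simp: stable_def dest: A_sym)

section \<open>Vertex recursion for the alternating count\<close>

lemma alternating_count_rec:
  assumes "finite W" "v \<in> W"
  shows "alternating_count W
    = alternating_count (W - {v}) - alternating_count (W - {v} - nbrs W v)"
proof -
  let ?X = "{S. S \<subseteq> W - {v} \<and> stable S}"
  let ?Y = "{S. S \<subseteq> W - {v} - nbrs W v \<and> stable S}"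
  have fin: "finite ?X" "finite ?Y"
    using assms(1) by simp_all
  have split: "{S. S \<subseteq> W \<and> stable S} = ?X \<union> insert v ` ?Y"
  proof (intro equalityI subsetI)
    fix S assume S: "S \<in> {S. S \<subseteq> W \<and> stable S}"
    show "S \<in> ?X \<union> insert v ` ?Y"
    proof (cases "v \<in> S")
      case True
      have "stable (insert v (S - {v}))"
        using S True by (simp add: insert_absorb)
      then have "S - {v} \<in> ?Y"
        using S unfolding stable_insert nbrs_def by blast
      moreover have "S = insert v (S - {v})"
        using True by blast
      ultimately show ?thesis by blast
    qed (use S in blast)
  next
    fix S assume "S \<in> ?X \<union> insert v ` ?Y"
    then show "S \<in> {S. S \<subseteq> W \<and> stable S}"
      using assms(2) by (auto simp: stable_insert nbrs_def)
  qed
  have inj: "inj_on (insert v) ?Y"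
    by (rule inj_onI) (auto simp: insert_ident)
  have "alternating_count W = (\<Sum>S\<in>?X. (- 1) ^ card S) + (\<Sum>S\<in>insert v ` ?Y. (- 1) ^ card S)"
    unfolding alternating_count_def split
    by (rule sum.union_disjoint) (use fin in auto)
  also have "(\<Sum>S\<in>insert v ` ?Y. (- 1) ^ card S) = (\<Sum>S\<in>?Y. - ((- 1 :: int) ^ card S))"
    unfolding sum.reindex[OF inj] comp_def
  proof (rule sum.cong)
    fix S assume "S \<in> ?Y"
    then have "finite S" "v \<notin> S"
      using assms(1) finite_subset by auto
    then show "(- 1 :: int) ^ card (insert v S) = - ((- 1) ^ card S)" by simp
  qed simp
  finally show ?thesis
    by (simp add: alternating_count_def sum_negf)
qed

text \<open>With no neighbours to remove, the two terms of the recursion coincide and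
  cancel.\<close>

lemma alternating_count_isolated:
  assumes "finite W" "v \<in> W" "nbrs W v = {}"
  shows "alternating_count W = 0"
  using alternating_count_rec[OF assms(1,2)] assms(3) by simp

text \<open>The recursion is applied at the neighbour \<open>u\<close>, not at the leaf
  \<open>v\<close>: only one term survives, so the later bound loses no factor 2 here.\<close>

lemma alternating_count_leaf:
  assumes "finite W" "v \<in> W" "nbrs W v = {u}"
  shows "alternating_count W = - alternating_count (W - {u} - nbrs W u)"
proof -
  have u: "u \<in> W" "u \<noteq> v"
    using assms(3) by (auto simp: nbrs_def)
  have "nbrs (W - {u}) v = {}"
    using assms(3) by (auto simp: nbrs_def)
  then have "alternating_count (W - {u}) = 0"
    using assms(1,2) u by (intro alternating_count_isolated[of _ v]) auto
  then show ?thesis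
    using alternating_count_rec[OF assms(1) u(1)] by simp
qed

section \<open>Components and deletion of a vertex\<close>

lemma component_of_self [simp]: "u \<in> component_of W u"
  by (simp add: component_of_def)

lemma component_of_sym: "w \<in> component_of W u \<Longrightarrow> u \<in> component_of W w"
proof -
  have "sym ((A \<inter> W \<times> W)\<^sup>*)"
    by (rule sym_rtrancl) (auto intro: symI A_sym)
  then show "w \<in> component_of W u \<Longrightarrow> u \<in> component_of W w"
    by (auto simp: component_of_def dest: symD)
qed

lemma component_of_eq:
  assumes "w \<in> component_of W u"
  shows "component_of W w = component_of W u"
  using assms component_of_sym[OF assms]
  by (auto simp: component_of_def intro: rtrancl_trans)

lemma component_of_mono: "W' \<subseteq> W \<Longrightarrow> component_of W' u \<subseteq> component_of W u"
  unfolding component_of_def by (intro Image_mono rtrancl_mono) auto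

lemma component_of_step:
  "\<lbrakk>x \<in> component_of W u; (x, y) \<in> A; x \<in> W; y \<in> W\<rbrakk> \<Longrightarrow> y \<in> component_of W u"
  unfolding component_of_def by (auto intro: rtrancl_into_rtrancl)

text \<open>Reduces an upper bound on a component to closure under a single step.\<close>

lemma component_of_least:
  assumes "u \<in> C" "\<And>x y. \<lbrakk>x \<in> C; (x, y) \<in> A; x \<in> W; y \<in> W\<rbrakk> \<Longrightarrow> y \<in> C"
  shows "component_of W u \<subseteq> C"
proof
  fix w assume "w \<in> component_of W u"
  then have "(u, w) \<in> (A \<inter> W \<times> W)\<^sup>*"
    by (simp add: component_of_def)
  then show "w \<in> C"
    by (induction rule: rtrancl_induct) (use assms in auto)
qed

lemma component_of_subset: "u \<in> W \<Longrightarrow> component_of W u \<subseteq> W"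
  by (rule component_of_least)

text \<open>\<open>T\<close> collects the components of \<open>W - {v}\<close> that contain a
  neighbour of \<open>v\<close>. Putting \<open>v\<close> back merges exactly these into one and
  leaves the others unchanged.\<close>

lemma component_of_delete:
  assumes "v \<in> W"
  defines "T \<equiv> component_of (W - {v}) ` nbrs W v"
  shows "component_of W v = insert v (\<Union>T)" (is ?center)
    and "component_of W ` W = insert (insert v (\<Union>T)) (component_of (W - {v}) ` (W - {v}) - T)"
proof -
  have nbr: "n \<in> W - {v}" "(v, n) \<in> A" if "n \<in> nbrs W v" for n
    using that by (auto simp: nbrs_def)
  show center: ?center
  proof
    show "component_of W v \<subseteq> insert v (\<Union>T)"
    proof (rule component_of_least)
      fix x y
      assume x: "x \<in> insert v (\<Union>T)" and xy: "(x, y) \<in> A" "x \<in> W" "y \<in> W"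
      show "y \<in> insert v (\<Union>T)"
      proof (cases "x = v")
        case True
        then have "y \<in> nbrs W v"
          using xy by (simp add: nbrs_def)
        then show ?thesis
          unfolding T_def using component_of_self by fast
      next
        case False
        then obtain n where n: "n \<in> nbrs W v" "x \<in> component_of (W - {v}) n"
          using x by (auto simp: T_def)
        then have "y \<in> component_of (W - {v}) n" if "y \<noteq> v"
          using component_of_step[OF n(2) xy(1)] xy that False by blast
        then show ?thesis
          using n(1) by (auto simp: T_def)
      qed
    qed simp
  next
    have "component_of (W - {v}) n \<subseteq> component_of W v" if n: "n \<in> nbrs W v" for n
    proof -
      have "n \<in> component_of W v"
        using component_of_step[of v W v n] nbr[OF n] assms(1) by simp
      then show ?thesis
        using component_of_eq component_of_mono[of "W - {v}" W n] by blast
    qed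
    then show "insert v (\<Union>T) \<subseteq> component_of W v"
      by (auto simp: T_def)
  qed
  have touching: "component_of W u = insert v (\<Union>T)"
    if "u \<in> W - {v}" "component_of (W - {v}) u \<in> T" for u
  proof -
    have "u \<in> component_of W v"
      unfolding center using that(2) component_of_self[of u "W - {v}"] by blast
    then show ?thesis
      unfolding center[symmetric] by (rule component_of_eq)
  qed
  have avoiding: "component_of W u = component_of (W - {v}) u"
    if u: "u \<in> W - {v}" and C: "component_of (W - {v}) u \<notin> T" for u
  proof
    show "component_of W u \<subseteq> component_of (W - {v}) u"
    proof (rule component_of_least)
      fix x y
      assume x: "x \<in> component_of (W - {v}) u" and xy: "(x, y) \<in> A" "x \<in> W" "y \<in> W"
      have xv: "x \<noteq> v"
        using component_of_subset[OF u] x by blast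
      \<comment> \<open>A step into \<open>v\<close> would start at a neighbour of \<open>v\<close>,
        which would put the component of \<open>u\<close> into \<open>T\<close>.\<close>
      have "y \<noteq> v"
      proof
        assume "y = v"
        then have "x \<in> nbrs W v"
          using xy by (auto simp: nbrs_def dest: A_sym)
        then have "component_of (W - {v}) u \<in> T"
          using component_of_eq[OF x] by (auto simp: T_def)
        then show False using C by simp
      qed
      then show "y \<in> component_of (W - {v}) u"
        using component_of_step[OF x xy(1)] xy xv by simp
    qed simp
  qed (auto intro!: component_of_mono)
  show "component_of W ` W = insert (insert v (\<Union>T)) (component_of (W - {v}) ` (W - {v}) - T)"
    (is "?L = ?R")
  proof (intro equalityI subsetI)
    fix C assume "C \<in> ?L"
    then obtain u where "u \<in> W" "C = component_of W u" by blast
    then show "C \<in> ?R"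
      using center touching[of u] avoiding[of u]
      by (cases "u = v"; cases "component_of (W - {v}) u \<in> T") auto
  next
    fix C assume "C \<in> ?R"
    then consider "C = component_of W v"
      | u where "u \<in> W - {v}" "C = component_of (W - {v}) u" "C \<notin> T"
      using center by blast
    then show "C \<in> ?L"
      using assms(1) avoiding by cases auto
  qed
qed

section \<open>Edge counts and the cyclomatic number under vertex deletion\<close>

lemma finite_edge_set: "finite W \<Longrightarrow> finite (edge_set W)"
  by (rule finite_subset[of _ "Pow W"]) (auto simp: edge_set_def)

lemma card_edge_set_delete:
  assumes "finite W" "v \<in> W"
  shows "card (edge_set W) = card (edge_set (W - {v})) + card (nbrs W v)"
proof -
  have "edge_set W = edge_set (W - {v}) \<union> (\<lambda>u. {v, u}) ` nbrs W v"
  proof (intro equalityI subsetI)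
    fix e assume "e \<in> edge_set W"
    then obtain a b where ab: "e = {a, b}" "a \<in> W" "b \<in> W" "(a, b) \<in> A"
      by (auto simp: edge_set_def)
    consider "a = v" | "b = v" | "a \<noteq> v" "b \<noteq> v" by blast
    then show "e \<in> edge_set (W - {v}) \<union> (\<lambda>u. {v, u}) ` nbrs W v"
    proof cases
      case 1
      then show ?thesis using ab by (auto simp: nbrs_def)
    next
      case 2
      then have "e = {v, a}" "a \<in> nbrs W v"
        using ab A_sym by (auto simp: nbrs_def)
      then show ?thesis by blast
    next
      case 3
      then have "e \<in> edge_set (W - {v})"
        unfolding edge_set_def using ab by blast
      then show ?thesis ..
    qed
  next
    fix e assume "e \<in> edge_set (W - {v}) \<union> (\<lambda>u. {v, u}) ` nbrs W v"
    then show "e \<in> edge_set W"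
      using assms(2) unfolding edge_set_def nbrs_def by blast
  qed
  moreover have "edge_set (W - {v}) \<inter> (\<lambda>u. {v, u}) ` nbrs W v = {}"
  proof -
    have "v \<notin> e" if "e \<in> edge_set (W - {v})" for e
      using that by (auto simp: edge_set_def)
    then show ?thesis by blast
  qed
  moreover have "inj_on (\<lambda>u. {v, u}) (nbrs W v)"
    by (auto intro!: inj_onI simp: doubleton_eq_iff)
  moreover have "finite (nbrs W v)"
    using assms(1) by (simp add: nbrs_def)
  ultimately show ?thesis
    using assms(1) by (simp add: card_Un_disjoint finite_edge_set card_image)
qed

text \<open>Deleting \<open>v\<close> loses one edge per neighbour and one vertex, and splits one
  component into those of \<open>?T\<close>. The lost vertex cancels against the merged
  component.\<close>

lemma nu_delete:
  assumes "finite W" "v \<in> W"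
  shows "nu W = nu (W - {v}) + int (card (nbrs W v))
    - int (card (component_of (W - {v}) ` nbrs W v))"
proof -
  let ?K = "component_of (W - {v}) ` (W - {v})"
  let ?T = "component_of (W - {v}) ` nbrs W v"
  have "nbrs W v \<subseteq> W - {v}"
    by (auto simp: nbrs_def)
  then have TK: "?T \<subseteq> ?K"
    by (rule image_mono)
  have fin: "finite ?K"
    using assms(1) by simp
  \<comment> \<open>The merged component contains \<open>v\<close>, so it is new and adds exactly
    one to the count, also when \<open>?T\<close> is empty.\<close>
  have "insert v (\<Union>?T) \<notin> ?K"
  proof
    assume "insert v (\<Union>?T) \<in> ?K"
    then obtain u where "u \<in> W - {v}" "insert v (\<Union>?T) = component_of (W - {v}) u"
      by blast
    then show False
      using component_of_subset[of u "W - {v}"] by blast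
  qed
  then have "card (component_of W ` W) = Suc (card (?K - ?T))"
    unfolding component_of_delete(2)[OF assms(2)] using fin by (subst card_insert_disjoint) auto
  also have "card (?K - ?T) = card ?K - card ?T"
    using TK fin by (meson card_Diff_subset finite_subset)
  finally have "int (card (component_of W ` W)) = int (card ?K) - int (card ?T) + 1"
    using card_mono[OF fin TK] by linarith
  moreover have "int (card W) = int (card (W - {v})) + 1"
    using card_Suc_Diff1[OF assms] by linarith
  ultimately show ?thesis
    unfolding nu_def card_edge_set_delete[OF assms] by linarith
qed

section \<open>Monotonicity of the cyclomatic number and the acyclic case\<close>

lemma finite_nbrs: "finite W \<Longrightarrow> finite (nbrs W v)"
  by (simp add: nbrs_def)

text \<open>The neighbours of \<open>v\<close> meet at most as many components as there are
  neighbours.\<close>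

lemma nu_delete_le:
  assumes "finite W"
  shows "nu (W - {v}) \<le> nu W"
proof (cases "v \<in> W")
  case True
  then show ?thesis
    using nu_delete[OF assms True] card_image_le[OF finite_nbrs[OF assms], of "component_of (W - {v})" v]
    by linarith
qed simp

lemma nu_mono:
  assumes "finite W" "W' \<subseteq> W"
  shows "nu W' \<le> nu W"
proof -
  have "nu (W - D) \<le> nu W" if "finite D" for D
    using that
  proof induction
    case (insert d D)
    have "W - insert d D = W - D - {d}" by blast
    then show ?case
      using nu_delete_le[of "W - D" d] assms(1) insert.IH by simp
  qed simp
  from this[of "W - W'"] show ?thesis
    using assms by (simp add: double_diff)
qed

text \<open>With \<open>nu_mono\<close> this makes \<open>nu\<close> nonnegative on finite sets, so
  that \<open>nat\<close> does not truncate the exponents.\<close>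

lemma nu_empty [simp]: "nu {} = 0"
  by (simp add: nu_def edge_set_def)

text \<open>Two neighbours of \<open>v\<close> in one component of \<open>W - {v}\<close> would
  close a cycle through \<open>v\<close>. As injectivity, this is exactly the case in which the
  correction in \<open>nu_delete\<close> vanishes.\<close>

definition acyclic_on :: "'a set \<Rightarrow> bool" where
  "acyclic_on W \<longleftrightarrow> (\<forall>v\<in>W. inj_on (component_of (W - {v})) (nbrs W v))"

text \<open>Components only grow with the vertex set, so neighbours joined inside \<open>W'\<close>
  are joined inside \<open>W\<close>.\<close>

lemma acyclic_on_subset:
  assumes "acyclic_on W" "W' \<subseteq> W"
  shows "acyclic_on W'"
  unfolding acyclic_on_def
proof (intro ballI inj_onI)
  fix v a b
  assume v: "v \<in> W'" and ab: "a \<in> nbrs W' v" "b \<in> nbrs W' v"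
    and eq: "component_of (W' - {v}) a = component_of (W' - {v}) b"
  have "b \<in> component_of (W - {v}) a"
    using eq component_of_mono[of "W' - {v}" "W - {v}" a] assms(2) component_of_self[of b "W' - {v}"]
    by blast
  then have "component_of (W - {v}) a = component_of (W - {v}) b"
    using component_of_eq by blast
  moreover have "a \<in> nbrs W v" "b \<in> nbrs W v"
    using ab assms(2) by (auto simp: nbrs_def)
  ultimately show "a = b"
    using assms v by (auto simp: acyclic_on_def dest: inj_onD)
qed

lemma nu_acyclic:
  assumes "finite W" "acyclic_on W"
  shows "nu W = 0"
  using assms
proof (induction W rule: finite_remove_induct)
  case (remove W)
  then obtain v where v: "v \<in> W" by blast
  have "acyclic_on (W - {v})"
    using remove.prems by (rule acyclic_on_subset) blast
  then have "nu (W - {v}) = 0"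
    using remove.IH[OF v] by blast
  moreover have "card (component_of (W - {v}) ` nbrs W v) = card (nbrs W v)"
    using remove.prems v by (auto simp: acyclic_on_def intro: card_image)
  ultimately show ?case
    using nu_delete[OF remove.hyps(1) v] by simp
qed simp

text \<open>Handshake lemma by double counting of incidences. Irreflexivity gives each edge two
  distinct ends.\<close>

lemma sum_card_nbrs:
  assumes "finite W"
  shows "(\<Sum>v\<in>W. card (nbrs W v)) = 2 * card (edge_set W)"
proof -
  have "card (nbrs W v) = card {e \<in> edge_set W. v \<in> e}" if v: "v \<in> W" for v
  proof -
    have "{e \<in> edge_set W. v \<in> e} = (\<lambda>u. {v, u}) ` nbrs W v"
    proof (intro equalityI subsetI)
      fix e assume "e \<in> {e \<in> edge_set W. v \<in> e}"
      then obtain a b where ab: "e = {a, b}" "a \<in> W" "b \<in> W" "(a, b) \<in> A" "v \<in> {a, b}"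
        by (auto simp: edge_set_def)
      then have "e = {v, b} \<and> b \<in> nbrs W v \<or> e = {v, a} \<and> a \<in> nbrs W v"
        using A_sym[of a b] by (auto simp: nbrs_def)
      then show "e \<in> (\<lambda>u. {v, u}) ` nbrs W v" by blast
    next
      fix e assume "e \<in> (\<lambda>u. {v, u}) ` nbrs W v"
      then show "e \<in> {e \<in> edge_set W. v \<in> e}"
        using v unfolding edge_set_def nbrs_def by blast
    qed
    moreover have "inj_on (\<lambda>u. {v, u}) (nbrs W v)"
      by (auto intro!: inj_onI simp: doubleton_eq_iff)
    ultimately show ?thesis
      by (simp add: card_image)
  qed
  then have "(\<Sum>v\<in>W. card (nbrs W v)) = (\<Sum>v\<in>W. card {e \<in> edge_set W. v \<in> e})"
    by simp
  also have "\<dots> = 2 * card (edge_set W)"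
  proof (rule sum_multicount[OF assms finite_edge_set[OF assms]], rule ballI)
    fix e assume "e \<in> edge_set W"
    then obtain a b where ab: "e = {a, b}" "a \<in> W" "b \<in> W" "(a, b) \<in> A"
      by (auto simp: edge_set_def)
    then have "{v \<in> W. v \<in> e} = {a, b}" "a \<noteq> b" by auto
    then show "card {v \<in> W. v \<in> e} = 2" by simp
  qed
  finally show ?thesis .
qed

text \<open>If all degrees were at least 2, the handshake lemma would give at least as many edges as
  vertices. Then \<open>nu W\<close> would be at least the number of components, hence positive,
  against \<open>nu_acyclic\<close>.\<close>

lemma acyclic_on_low_degree:
  assumes "finite W" "W \<noteq> {}" "acyclic_on W"
  obtains v where "v \<in> W" "card (nbrs W v) \<le> 1"
proof (rule ccontr)
  assume "\<not> thesis"
  then have "2 \<le> card (nbrs W v)" if "v \<in> W" for v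
    using \<open>\<And>v. \<lbrakk>v \<in> W; card (nbrs W v) \<le> 1\<rbrakk> \<Longrightarrow> thesis\<close>[of v] that by linarith
  then have "2 * card W \<le> (\<Sum>v\<in>W. card (nbrs W v))"
    using sum_mono[of W "\<lambda>_. 2" "\<lambda>v. card (nbrs W v)"] by simp
  then have "card W \<le> card (edge_set W)"
    using sum_card_nbrs[OF assms(1)] by linarith
  moreover have "card (component_of W ` W) > 0"
    using assms by (simp add: card_gt_0_iff)
  ultimately show False
    using nu_acyclic[OF assms(1,3)] by (simp add: nu_def)
qed

section \<open>The bound, by induction on the vertex set\<close>

lemma abs_alternating_count_le:
  assumes "finite W"
  shows "\<bar>alternating_count W\<bar> \<le> 2 ^ nat (nu W)"
  using assms
proof (induction W rule: finite_psubset_induct)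
  case (psubset W)
  note fin = psubset.hyps
  have bound: "\<bar>alternating_count U\<bar> \<le> 2 ^ k" if "U \<subset> W" "nat (nu U) \<le> k" for U k
    using psubset.IH[OF that(1)] power_increasing[OF that(2), of "2::int"] by linarith
  consider "W = {}" | "W \<noteq> {}" "acyclic_on W" | "\<not> acyclic_on W" by blast
  then show ?case
  proof cases
    case 1
    have "{S :: 'a set. S = {} \<and> stable S} = {{}}" by auto
    then show ?thesis
      using 1 by (simp add: alternating_count_def)
  next
    case 2
    then obtain v where v: "v \<in> W" "card (nbrs W v) \<le> 1"
      using acyclic_on_low_degree fin by blast
    then consider "nbrs W v = {}" | u where "nbrs W v = {u}"
      using finite_nbrs[OF fin, of v]
      by (metis One_nat_def card_0_eq card_1_singletonE le_SucE le_zero_eq)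
    then show ?thesis
    proof cases
      case 1
      then show ?thesis
        using alternating_count_isolated[OF fin v(1)] by simp
    next
      case (2 u)
      then have "u \<in> W"
        by (auto simp: nbrs_def)
      then have "W - {u} - nbrs W u \<subset> W" by blast
      moreover from this have "nu (W - {u} - nbrs W u) \<le> nu W"
        using nu_mono[OF fin] by blast
      ultimately show ?thesis
        using bound alternating_count_leaf[OF fin v(1) 2] by simp
    qed
  next
    case 3
    then obtain v where v: "v \<in> W" "\<not> inj_on (component_of (W - {v})) (nbrs W v)"
      by (auto simp: acyclic_on_def)
    \<comment> \<open>On a finite set a map that is not injective has a strictly smaller image, so
      deleting \<open>v\<close> lowers \<open>nu\<close> by at least one.\<close>
    have "card (component_of (W - {v}) ` nbrs W v) < card (nbrs W v)"
      using v(2) finite_nbrs[OF fin] card_image_le eq_card_imp_inj_on le_neq_implies_less by metis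
    then have del: "nu (W - {v}) < nu W"
      using nu_delete[OF fin v(1)] by linarith
    \<comment> \<open>Together with \<open>del\<close> this gives \<open>nu W\<close> \<ge> 1, so
      \<open>nat (nu W - 1)\<close> is a true predecessor and the factor 2 from the two terms fits
      into the exponent.\<close>
    have nonneg: "0 \<le> nu (W - {v})"
      using nu_mono[of "W - {v}" "{}"] fin by simp
    have "nu (W - {v} - nbrs W v) \<le> nu (W - {v})"
      by (rule nu_mono) (use fin in auto)
    with del have le: "nat (nu (W - {v})) \<le> nat (nu W - 1)"
        "nat (nu (W - {v} - nbrs W v)) \<le> nat (nu W - 1)"
      by linarith+
    have "W - {v} \<subset> W" "W - {v} - nbrs W v \<subset> W"
      using v(1) by auto
    from bound[OF this(1) le(1)] bound[OF this(2) le(2)]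
    have "\<bar>alternating_count W\<bar> \<le> 2 * 2 ^ nat (nu W - 1)"
      unfolding alternating_count_rec[OF fin v(1)] by linarith
    also have "\<dots> = 2 ^ Suc (nat (nu W - 1))" by simp
    also have "Suc (nat (nu W - 1)) = nat (nu W)"
      using del nonneg by linarith
    finally show ?thesis .
  qed
qed

end

section \<open>Connected components as strongly connected components\<close>

lemma (in sym_digraph) strongly_connected_induce_connected:
  assumes "subgraph H G" "Digraph_Component.connected H"
  shows "strongly_connected (G \<restriction> verts H)"
proof
  show "verts (G \<restriction> verts H) \<noteq> {}"
    using assms(2) by (auto simp: Digraph_Component.connected_def strongly_connected_def)
next
  fix u v assume uv: "u \<in> verts (G \<restriction> verts H)" "v \<in> verts (G \<restriction> verts H)"
  interpret H: wf_digraph H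
    using assms(1) by blast
  have ends: "tail H = tail G" "head H = head G" and arcs: "arcs H \<subseteq> arcs G"
    using assms(1) by (auto simp: subgraph_def compatible_def)
  \<comment> \<open>\<open>H\<close> may contain only one arc of an opposite pair. The missing
    reversals lie in \<open>G\<close> because \<open>G\<close> is symmetric, and the induced
    subgraph keeps them.\<close>
  have "parcs (mk_symmetric H) \<subseteq> arcs_ends (G \<restriction> verts H)"
  proof
    fix p assume "p \<in> parcs (mk_symmetric H)"
    then obtain e where e: "e \<in> arcs H"
      "p = (tail G e, head G e) \<or> p = (head G e, tail G e)"
      by (auto simp: parcs_mk_symmetric ends)
    have V: "tail G e \<in> verts H" "head G e \<in> verts H"
      using H.wellformed[OF e(1)] ends by simp_all
    have "(tail G e, head G e) \<in> arcs_ends G"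
      using e(1) arcs by (auto simp: arcs_ends_conv)
    then have "p \<in> arcs_ends G"
      using e(2) graph_symmetric by blast
    then show "p \<in> arcs_ends (G \<restriction> verts H)"
      using V e(2) by (auto simp: arcs_ends_conv)
  qed
  moreover have "u \<rightarrow>\<^sup>*\<^bsub>with_proj (mk_symmetric H)\<^esub> v"
    using assms(2) uv by (auto simp: Digraph_Component.connected_def strongly_connected_def)
  ultimately show "u \<rightarrow>\<^sup>*\<^bsub>G \<restriction> verts H\<^esub> v"
    unfolding reachable_def by (auto intro: rtrancl_on_mono)
qed

lemma (in wf_digraph) strongly_connected_imp_connected:
  "strongly_connected G \<Longrightarrow> Digraph_Component.connected G"
  by (auto simp: Digraph_Component.connected_def strongly_connected_def
      intro: reachable_mk_symmetricI)

text \<open>Connectedness ignores arc directions and strong connectedness does not, yet the maximal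
  subgraphs agree: passing to the induced subgraph on the same vertices turns the first into the
  second. This makes the theory of \<open>sccs\<close> available for counting components.\<close>

lemma (in sym_digraph) connected_components_eq_sccs: "connected_components G = sccs"
proof -
  have sc_conn: "Digraph_Component.connected H" if "subgraph H G" "strongly_connected H" for H
    using that by (auto intro: wf_digraph.strongly_connected_imp_connected)
  have induce: "subgraph H (G \<restriction> verts H)" "subgraph (G \<restriction> verts H) G" if "subgraph H G" for H
    using that subgraph_induce_subgraphI2 subgraph_induce_subgraphI subgraph_imp_subverts
    by blast+
  have "max_subgraph Digraph_Component.connected H \<longleftrightarrow> max_subgraph strongly_connected H" for H
  proof
    assume max: "max_subgraph Digraph_Component.connected H"
    then have H: "subgraph H G" "Digraph_Component.connected H"
      by (auto simp: max_subgraph_def)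
    have "strongly_connected (G \<restriction> verts H)"
      using H by (rule strongly_connected_induce_connected)
    \<comment> \<open>The induced subgraph contains \<open>H\<close> and is itself connected, so
      maximality of \<open>H\<close> forces equality.\<close>
    moreover from this have "G \<restriction> verts H = H"
      using max induce[OF H(1)] sc_conn unfolding max_subgraph_def by blast
    ultimately have "strongly_connected H" by simp
    then show "max_subgraph strongly_connected H"
      using max sc_conn unfolding max_subgraph_def by blast
  next
    assume max: "max_subgraph strongly_connected H"
    then have H: "subgraph H G" "strongly_connected H"
      by (auto simp: max_subgraph_def)
    show "max_subgraph Digraph_Component.connected H"
    proof (rule max_subgraphI)
      fix H'
      assume H': "H \<noteq> H'" "subgraph H H'" "subgraph H' G"
      show "\<not> Digraph_Component.connected H'"
      proof
        assume "Digraph_Component.connected H'"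
        then have "strongly_connected (G \<restriction> verts H')"
          using H'(3) by (intro strongly_connected_induce_connected)
        \<comment> \<open>The strongly connected induced subgraph lies above \<open>H\<close>, hence
          equals it. Thus \<open>H'\<close> is squeezed between \<open>H\<close> and
          \<open>H\<close>.\<close>
        then have "G \<restriction> verts H' = H"
          using max induce[OF H'(3)] subgraph_trans[OF H'(2)] unfolding max_subgraph_def by blast
        then have "subgraph H' H"
          using induce(1)[OF H'(3)] by simp
        then have "H = H'"
          using H'(2) by (auto simp: subgraph_def compatible_def)
        then show False using H'(1) by simp
      qed
    qed (use H sc_conn in auto)
  qed
  then show ?thesis
    by (simp add: connected_components_def sccs_altdef2)
qed

section \<open>Evaluation at -1 and the passage back to graphs\<close>

lemma poly_independence_poly_minus_one:
  assumes "finite (verts G)"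
  shows "poly (independence_poly G) (- 1) = (\<Sum>S | stable_set G S. (- 1) ^ card S)"
proof -
  have fin: "finite {S. stable_set G S}"
    by (rule finite_subset[of _ "Pow (verts G)"]) (use assms in \<open>auto simp: stable_set_def\<close>)
  \<comment> \<open>Every stable set has at most \<open>card (verts G)\<close> elements, so grouping
    by size over this range misses none.\<close>
  have card: "card ` {S. stable_set G S} \<subseteq> {..card (verts G)}"
    using assms by (auto simp: stable_set_def intro: card_mono)
  have "poly (independence_poly G) (- 1)
    = (\<Sum>k\<le>card (verts G). int (stable_count G k) * (- 1) ^ k)"
    by (simp add: independence_poly_def poly_sum poly_monom)
  also have "\<dots> = (\<Sum>k\<le>card (verts G). \<Sum>S | S \<in> {S. stable_set G S} \<and> card S = k. (- 1) ^ card S)"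
    by (simp add: stable_count_def)
  also have "\<dots> = (\<Sum>S | stable_set G S. (- 1) ^ card S)"
    by (rule sum.group[OF fin _ card]) simp
  finally show ?thesis .
qed

context graph
begin

lemma adjacency_arcs_ends: "adjacency (arcs_ends G)"
proof
  show "sym (arcs_ends G)"
    using sym_arcs by (simp add: symmetric_def)
  show "irrefl (arcs_ends G)"
    using no_loops by (auto simp: irrefl_def arcs_ends_conv)
qed

interpretation adj: adjacency "arcs_ends G"
  by (rule adjacency_arcs_ends)

lemma poly_independence_poly_eq_alternating_count:
  "poly (independence_poly G) (- 1) = adj.alternating_count (verts G)"
proof -
  \<comment> \<open>\<open>pairwise\<close> skips equal vertices and \<open>adj.stable\<close> does
    not; the absence of loops reconciles the two.\<close>
  have "stable_set G S \<longleftrightarrow> S \<subseteq> verts G \<and> adj.stable S" for S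
    unfolding stable_set_def adj.stable_def pairwise_def using adj.A_irrefl by metis
  then show ?thesis
    by (simp add: poly_independence_poly_minus_one adj.alternating_count_def)
qed

lemma cyclomatic_number_eq_nu: "cyclomatic_number G = adj.nu (verts G)"
proof -
  have "edges G = adj.edge_set (verts G)"
  proof (intro equalityI subsetI)
    fix x assume "x \<in> edges G"
    then obtain e where "e \<in> arcs G" "x = {tail G e, head G e}"
      by (auto simp: edges_def)
    then show "x \<in> adj.edge_set (verts G)"
      unfolding adj.edge_set_def using wellformed in_arcs_imp_in_arcs_ends by blast
  next
    fix x assume "x \<in> adj.edge_set (verts G)"
    then obtain u v where "x = {u, v}" "(u, v) \<in> arcs_ends G"
      by (auto simp: adj.edge_set_def)
    then show "x \<in> edges G"
      by (auto simp: edges_def arcs_ends_conv)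
  qed
  \<comment> \<open>Arcs already end in \<open>verts G\<close>, so \<open>component_of\<close> is
    reachability in \<open>G\<close>. Since reachability is symmetric, it is also the strongly
    connected component.\<close>
  moreover have "arcs_ends G \<inter> verts G \<times> verts G = arcs_ends G"
    by (auto simp: arcs_ends_conv)
  then have "v \<in> adj.component_of (verts G) u \<longleftrightarrow> u \<rightarrow>\<^sup>* v" if "u \<in> verts G" for u v
    using that adj.component_of_subset[OF that]
    by (auto simp: adj.component_of_def reachable_conv)
  then have "adj.component_of (verts G) u = scc_of u" if "u \<in> verts G" for u
    using that symmetric_reachable' unfolding scc_of_def by blast
  then have "adj.component_of (verts G) ` verts G = sccs_verts"
    by (simp add: sccs_verts_conv_scc_of)
  ultimately show ?thesis
    by (simp add: cyclomatic_number_def adj.nu_def connected_components_eq_sccs card_sccs_verts)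
qed

lemma abs_independence_poly_le:
  "\<bar>real_of_int (poly (independence_poly G) (- 1))\<bar> \<le> 2 powi cyclomatic_number G"
proof -
  \<comment> \<open>For a negative exponent \<open>powi\<close> would give a reciprocal;
    nonnegativity identifies it with the natural power in the bound.\<close>
  have "0 \<le> cyclomatic_number G"
    using adj.nu_mono[of "verts G" "{}"] by (simp add: cyclomatic_number_eq_nu)
  then have "(2::real) powi cyclomatic_number G = of_int (2 ^ nat (cyclomatic_number G))"
    by (simp add: power_int_def)
  moreover have "\<bar>poly (independence_poly G) (- 1)\<bar> \<le> 2 ^ nat (cyclomatic_number G)"
    unfolding poly_independence_poly_eq_alternating_count cyclomatic_number_eq_nu
    by (rule adj.abs_alternating_count_le) simp
  ultimately show ?thesis
    by (metis of_int_abs of_int_le_iff)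
qed

end

theorem theorem3p1:
  fixes G :: "('a, 'b) pre_digraph"
  assumes "graph G"
  shows "- (2 powi cyclomatic_number G) \<le> real_of_int (poly (independence_poly G) (- 1))
    \<and> real_of_int (poly (independence_poly G) (- 1)) \<le> 2 powi cyclomatic_number G"
  using graph.abs_independence_poly_le[OF assms] by (simp add: abs_le_iff)

end
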